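(* Let $(X,\triangleleft)$ be a finite quandle with $r$ orbits whose structure group $G(X,\triangleleft)$ is abelian. Then its second homology group is torsion-free: $H_2(X,\triangleleft)\cong\mathbb{Z}^{r^2}$.
   Context: A quandle is a set $X$ with a binary operation $\triangleleft$ such that for all $a,b,c$: $(a\triangleleft b)\triangleleft c=(a\triangleleft c)\triangleleft(b\triangleleft c)$; the right translation $-\triangleleft b$ is a bijection of $X$; $a\triangleleft a=a$. Its orbits are the orbits of $X$ under the group generated by all right translations. Its structure group is $G(X,\triangleleft)=\langle g_a,\ a\in X\mid g_ag_b=g_bg_{a\triangleleft b},\ a,b\in X\rangle$. Rack homology. $H_\bullet(X,\triangleleft)$ is the homology of the chain complex $C_k=\mathbb{Z}X^k$ (free abelian group on $X^k$) with $d_k(a_1,\ldots,a_k)=\sum_{i=2}^k(-1)^{i-1}[(a_1,\ldots,\widehat{a_i},\ldots,a_k)-(a_1\triangleleft a_i,\ldots,a_{i-1}\triangleleft a_i,a_{i+1},\ldots,a_k)]$. In particular $d_2(a,b)=a\triangleleft b-a$, $d_3(a,b,c)=(a\triangleleft b,c)-(a,c)-(a\triangleleft c,b\triangleleft c)+(a,b)$, and $H_2=\ker d_2/\operatorname{im}d_3$. *)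

theory Defs
  imports "HOL-Algebra.Free_Abelian_Groups" "HOL-Algebra.Group_Action"
begin

section \<open>Quandles\<close>

locale quandle =
  fixes X :: "'a set" and qop :: "'a \<Rightarrow> 'a \<Rightarrow> 'a"
  assumes closed: "a \<in> X \<Longrightarrow> b \<in> X \<Longrightarrow> qop a b \<in> X"
    and self_distrib:
      "a \<in> X \<Longrightarrow> b \<in> X \<Longrightarrow> c \<in> X \<Longrightarrow> qop (qop a b) c = qop (qop a c) (qop b c)"
    and right_translation_bij: "b \<in> X \<Longrightarrow> bij_betw (\<lambda>a. qop a b) X X"
    and idem: "a \<in> X \<Longrightarrow> qop a a = a"

text \<open>The restriction outside \<open>X\<close> is needed because permutations in \<^const>\<open>BijGroup\<close>
  are extensional functions.\<close>

definition right_translation :: "'a set \<Rightarrow> ('a \<Rightarrow> 'a \<Rightarrow> 'a) \<Rightarrow> 'a \<Rightarrow> 'a \<Rightarrow> 'a"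
  where "right_translation X qop b = (\<lambda>a\<in>X. qop a b)"

definition quandle_orbits :: "'a set \<Rightarrow> ('a \<Rightarrow> 'a \<Rightarrow> 'a) \<Rightarrow> 'a set set"
  where "quandle_orbits X qop =
    orbits (subgroup_generated (BijGroup X) (right_translation X qop ` X)) X (\<lambda>f. f)"


section \<open>Groups given by generators and relations\<close>

text \<open>A word is a list of letters \<open>(True, a)\<close>, standing for the generator \<open>a\<close>, and
  \<open>(False, a)\<close>, standing for its formal inverse.  A relation \<open>u = v\<close> is a pair \<open>(u, v)\<close> of words.\<close>

type_synonym 'a word = "(bool \<times> 'a) list"

definition words :: "'a set \<Rightarrow> 'a word set"
  where "words S = lists (UNIV \<times> S)"

inductive word_eq :: "'a set \<Rightarrow> ('a word \<times> 'a word) set \<Rightarrow> 'a word \<Rightarrow> 'a word \<Rightarrow> bool"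
  for S :: "'a set" and R :: "('a word \<times> 'a word) set"
where
  refl: "w \<in> words S \<Longrightarrow> word_eq S R w w"
| sym: "word_eq S R u v \<Longrightarrow> word_eq S R v u"
| trans: "word_eq S R u v \<Longrightarrow> word_eq S R v w \<Longrightarrow> word_eq S R u w"
| append: "word_eq S R u u' \<Longrightarrow> word_eq S R v v' \<Longrightarrow> word_eq S R (u @ v) (u' @ v')"
| cancel: "a \<in> S \<Longrightarrow> word_eq S R [(e, a), (\<not> e, a)] []"
| relation: "(u, v) \<in> R \<Longrightarrow> u \<in> words S \<Longrightarrow> v \<in> words S \<Longrightarrow> word_eq S R u v"

definition word_rel :: "'a set \<Rightarrow> ('a word \<times> 'a word) set \<Rightarrow> ('a word \<times> 'a word) set"
  where "word_rel S R = {(u, v). word_eq S R u v}"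

definition presented_group :: "'a set \<Rightarrow> ('a word \<times> 'a word) set \<Rightarrow> 'a word set monoid"
  where "presented_group S R =
    \<lparr>carrier = words S // word_rel S R,
     mult = (\<lambda>A B. \<Union>u\<in>A. \<Union>v\<in>B. word_rel S R `` {u @ v}),
     one = word_rel S R `` {[]}\<rparr>"

definition structure_group :: "'a set \<Rightarrow> ('a \<Rightarrow> 'a \<Rightarrow> 'a) \<Rightarrow> 'a word set monoid"
  where "structure_group X qop = presented_group X
    {([(True, a), (True, b)], [(True, b), (True, qop a b)]) | a b. a \<in> X \<and> b \<in> X}"

lemma word_eq_words: "word_eq S R u v \<Longrightarrow> u \<in> words S \<and> v \<in> words S"
  by (induction rule: word_eq.induct) (auto simp: words_def)

lemma equiv_word_rel: "equiv (words S) (word_rel S R)"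
proof (rule equivI)
  show "word_rel S R \<subseteq> words S \<times> words S"
    by (auto simp: word_rel_def dest: word_eq_words)
  show "refl_on (words S) (word_rel S R)"
    by (auto simp: word_rel_def refl_on_def intro: word_eq.refl)
  show "Relation.sym (word_rel S R)"
    by (auto simp: word_rel_def Relation.sym_def intro: word_eq.sym)
  show "Relation.trans (word_rel S R)"
    by (auto simp: word_rel_def Relation.trans_def intro: word_eq.trans)
qed

lemma word_class_eqI: "word_eq S R u v \<Longrightarrow> word_rel S R `` {u} = word_rel S R `` {v}"
  by (rule equiv_class_eq[OF equiv_word_rel]) (simp add: word_rel_def)

lemma word_class_carrier: "u \<in> words S \<Longrightarrow> word_rel S R `` {u} \<in> carrier (presented_group S R)"
  by (simp add: presented_group_def quotientI)

lemma word_class_mult: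
  assumes "u \<in> words S" "v \<in> words S"
  shows "word_rel S R `` {u} \<otimes>\<^bsub>presented_group S R\<^esub> word_rel S R `` {v} = word_rel S R `` {u @ v}"
proof -
  let ?A = "word_rel S R `` {u}" and ?B = "word_rel S R `` {v}"
  have "word_rel S R `` {u' @ v'} = word_rel S R `` {u @ v}" if "u' \<in> ?A" "v' \<in> ?B" for u' v'
  proof (rule word_class_eqI)
    have "word_eq S R u u'" "word_eq S R v v'"
      using that by (simp_all add: word_rel_def)
    thus "word_eq S R (u' @ v') (u @ v)"
      by (intro word_eq.append) (rule word_eq.sym, assumption)+
  qed
  hence "(\<Union>u'\<in>?A. \<Union>v'\<in>?B. word_rel S R `` {u' @ v'})
      = (\<Union>u'\<in>?A. \<Union>v'\<in>?B. word_rel S R `` {u @ v})"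
    by (intro SUP_cong HOL.refl)
  moreover have "u \<in> ?A" "v \<in> ?B"
    using assms by (simp_all add: word_rel_def word_eq.refl)
  hence "?A \<noteq> {}" "?B \<noteq> {}" by blast+
  ultimately show ?thesis
    by (simp add: presented_group_def)
qed

lemma group_presented_group: "group (presented_group S R)"
proof -
  let ?G = "presented_group S R" and ?c = "\<lambda>u. word_rel S R `` {u}"
  have rep: "\<exists>u \<in> words S. x = ?c u" if "x \<in> carrier ?G" for x
    using that by (auto simp: presented_group_def quotient_def)
  have one: "\<one>\<^bsub>?G\<^esub> = ?c []"
    by (simp add: presented_group_def)
  have app: "u @ v \<in> words S" if "u \<in> words S" "v \<in> words S" for u v
    using that by (simp add: words_def)
  have nil: "[] \<in> words S"
    by (simp add: words_def)
  have inv: "\<exists>v \<in> words S. word_eq S R (v @ u) []" if "u \<in> words S" for u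
    using that
  proof (induction u)
    case Nil
    show ?case
      using nil by (intro bexI[of _ "[]"]) (auto intro: word_eq.refl)
  next
    case (Cons x u)
    then obtain e a where x: "x = (e, a)" and a: "a \<in> S" and u: "u \<in> words S"
      by (cases x) (auto simp: words_def)
    obtain v where v: "v \<in> words S" "word_eq S R (v @ u) []"
      using Cons.IH u by blast
    have "word_eq S R ([(\<not> e, a), (\<not> \<not> e, a)] @ u) ([] @ u)"
      using a u by (intro word_eq.append word_eq.cancel word_eq.refl)
    hence "word_eq S R (v @ [(\<not> e, a), (e, a)] @ u) (v @ u)"
      using v by (intro word_eq.append[OF word_eq.refl]) auto
    hence "word_eq S R ((v @ [(\<not> e, a)]) @ x # u) []"
      using v(2) x by (auto intro: word_eq.trans)
    moreover have "v @ [(\<not> e, a)] \<in> words S"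
      using v a by (simp add: words_def)
    ultimately show ?case by blast
  qed
  show ?thesis
  proof (rule groupI)
    show "\<one>\<^bsub>?G\<^esub> \<in> carrier ?G"
      by (simp add: one word_class_carrier nil)
  next
    fix x y assume "x \<in> carrier ?G" "y \<in> carrier ?G"
    then obtain u v where "u \<in> words S" "v \<in> words S" "x = ?c u" "y = ?c v"
      using rep by meson
    thus "x \<otimes>\<^bsub>?G\<^esub> y \<in> carrier ?G"
      by (simp add: word_class_mult app word_class_carrier)
  next
    fix x y z assume "x \<in> carrier ?G" "y \<in> carrier ?G" "z \<in> carrier ?G"
    then obtain u v w where "u \<in> words S" "v \<in> words S" "w \<in> words S"
      "x = ?c u" "y = ?c v" "z = ?c w"
      using rep by meson
    thus "x \<otimes>\<^bsub>?G\<^esub> y \<otimes>\<^bsub>?G\<^esub> z = x \<otimes>\<^bsub>?G\<^esub> (y \<otimes>\<^bsub>?G\<^esub> z)"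
      by (simp add: word_class_mult app)
  next
    fix x assume "x \<in> carrier ?G"
    then obtain u where "u \<in> words S" "x = ?c u" using rep by meson
    thus "\<one>\<^bsub>?G\<^esub> \<otimes>\<^bsub>?G\<^esub> x = x"
      by (simp add: word_class_mult one nil)
  next
    fix x assume "x \<in> carrier ?G"
    then obtain u where u: "u \<in> words S" "x = ?c u" using rep by blast
    then obtain v where v: "v \<in> words S" "word_eq S R (v @ u) []" using inv by blast
    have "?c v \<otimes>\<^bsub>?G\<^esub> x = \<one>\<^bsub>?G\<^esub>"
      using u v word_class_eqI[OF v(2)] by (simp add: word_class_mult one)
    thus "\<exists>y\<in>carrier ?G. y \<otimes>\<^bsub>?G\<^esub> x = \<one>\<^bsub>?G\<^esub>"
      using v word_class_carrier by blast
  qed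
qed


section \<open>Rack homology\<close>

text \<open>\<open>X\<^sup>k\<close> is the set of lists of length \<open>k\<close> over \<open>X\<close>.\<close>

definition rack_chain_group :: "'a set \<Rightarrow> nat \<Rightarrow> ('a list \<Rightarrow>\<^sub>0 int) monoid"
  where "rack_chain_group X k = free_Abelian_group {xs. length xs = k \<and> set xs \<subseteq> X}"

text \<open>The index \<open>i\<close> runs over the positions \<open>2, \<dots>, k\<close> counted from \<open>1\<close>, so the entry
  \<open>a\<^sub>i\<close> is \<open>xs ! (i - 1)\<close>, the entries before it are \<open>take (i - 1) xs\<close> and those after it
  are \<open>drop i xs\<close>.\<close>

definition rack_boundary_basis :: "('a \<Rightarrow> 'a \<Rightarrow> 'a) \<Rightarrow> 'a list \<Rightarrow> 'a list \<Rightarrow>\<^sub>0 int"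
  where "rack_boundary_basis qop xs =
    (\<Sum>i = 2..length xs. frag_cmul ((-1) ^ (i - 1))
      (frag_of (take (i - 1) xs @ drop i xs) -
       frag_of (map (\<lambda>a. qop a (xs ! (i - 1))) (take (i - 1) xs) @ drop i xs)))"

definition rack_boundary :: "('a \<Rightarrow> 'a \<Rightarrow> 'a) \<Rightarrow> ('a list \<Rightarrow>\<^sub>0 int) \<Rightarrow> ('a list \<Rightarrow>\<^sub>0 int)"
  where "rack_boundary qop = frag_extend (rack_boundary_basis qop)"

text \<open>The degree is built into the chain groups: \<open>rack_boundary\<close> restricted to
  \<open>rack_chain_group X k\<close> is \<open>d\<^sub>k\<close>.  It vanishes for \<open>k \<le> 1\<close>, so truncated subtraction is harmless
  at \<open>k = 0\<close>.\<close>

definition rack_homology ::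
    "'a set \<Rightarrow> ('a \<Rightarrow> 'a \<Rightarrow> 'a) \<Rightarrow> nat \<Rightarrow> ('a list \<Rightarrow>\<^sub>0 int) set monoid"
  where "rack_homology X qop k =
    subgroup_generated (rack_chain_group X k)
        (kernel (rack_chain_group X k) (rack_chain_group X (k - 1)) (rack_boundary qop))
      Mod (rack_boundary qop ` carrier (rack_chain_group X (k + 1)))"

lemma rack_boundary_2:
  "rack_boundary qop (frag_of [a, b]) = frag_of [qop a b] - frag_of [a]"
proof -
  have "{2..length [a, b]} = {2}" by auto
  thus ?thesis
    by (simp add: rack_boundary_def rack_boundary_basis_def del: length_Cons)
qed

lemma rack_boundary_3:
  "rack_boundary qop (frag_of [a, b, c]) =
    frag_of [qop a b, c] - frag_of [a, c] - frag_of [qop a c, qop b c] + frag_of [a, b]"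
proof -
  have "{2..length [a, b, c]} = {2, 3}" by auto
  thus ?thesis
    by (simp add: rack_boundary_def rack_boundary_basis_def del: length_Cons)
qed


section \<open>Torsion-free groups\<close>

definition torsion_free :: "('a, 'b) monoid_scheme \<Rightarrow> bool"
  where "torsion_free G \<longleftrightarrow>
    (\<forall>x \<in> carrier G. \<forall>n::nat. n > 0 \<longrightarrow> x [^]\<^bsub>G\<^esub> n = \<one>\<^bsub>G\<^esub> \<longrightarrow> x = \<one>\<^bsub>G\<^esub>)"

end

theory Submission
  imports Defs
begin

text \<open>A basis element \<open>(a, b)\<close> of \<open>C\<^sub>2\<close> is an edge from \<open>a\<close> to \<open>a \<triangleleft> b\<close> labelled by
  \<open>b\<close>, and two paths from the same vertex whose words agree in the structure group differ by
  an element of the image of \<open>d\<^sub>3\<close>.  Sending \<open>(a, b)\<close> to the pair of the orbits of \<open>a\<close> and \<open>b\<close> is well defined on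
  \<open>H\<^sub>2\<close>.  Modulo boundaries a cycle is a sum of loops, one at a base point of each orbit.  If the
  structure group is abelian, it is generated by one element per orbit, so a loop whose exponent sums
  all vanish spells the trivial element and is a boundary: the map from \<open>H\<^sub>2\<close> to the free abelian group
  on pairs of orbits is injective.  As \<open>X\<close> is finite, \<open>b\<close> acts with finite period on \<open>a\<close>, so the image
  contains a multiple of each basis element, and a subgroup of this kind is free of rank \<open>r\<^sup>2\<close>.\<close>

section \<open>Full-rank subgroups of free abelian groups\<close>

text \<open>Induction on \<open>J\<close> by Euclidean division: a basis of the elements of
  \<open>L\<close> without \<open>j\<close>-coefficient is completed by an element of
  \<open>L\<close> whose \<open>j\<close>-coefficient is positive and least. The basis can be
  indexed by \<open>J\<close> itself because each \<open>j\<close> has a nonzero multiple in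
  \<open>L\<close>.\<close>

lemma full_rank_sublattice_basis:
  assumes "finite J"
    and "L \<subseteq> carrier (free_Abelian_group J)"
    and "0 \<in> L"
    and "\<And>x y. x \<in> L \<Longrightarrow> y \<in> L \<Longrightarrow> x - y \<in> L"
    and "\<And>j. j \<in> J \<Longrightarrow> \<exists>n. n \<noteq> 0 \<and> frag_cmul n (frag_of j) \<in> L"
  shows "\<exists>f. bij_betw (frag_extend f) (carrier (free_Abelian_group J)) L"
  using assms
proof (induction J arbitrary: L rule: finite_induct)
  case empty
  hence "L = {0}" "carrier (free_Abelian_group {}) = {0 :: 'a \<Rightarrow>\<^sub>0 int}" by auto
  thus ?case by (simp add: bij_betw_def)
next
  case (insert j J)
  note diff = insert.prems(3)
  have add: "x + y \<in> L" if "x \<in> L" "y \<in> L" for x y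
    using diff[OF that(1) diff[OF insert.prems(2) that(2)]] by simp
  have cmul: "frag_cmul k x \<in> L" if "x \<in> L" for k x
    using frag_closure_minus_cmul[of "\<lambda>x. x \<in> L"] insert.prems(2) diff that by blast
  define L' where "L' = {x \<in> L. Poly_Mapping.keys x \<subseteq> J}"
  have "\<exists>f. bij_betw (frag_extend f) (carrier (free_Abelian_group J)) L'"
  proof (rule insert.IH)
    show "x - y \<in> L'" if "x \<in> L'" "y \<in> L'" for x y
      using that diff[of x y] keys_diff[of x y] unfolding L'_def by blast
    show "\<exists>n. n \<noteq> 0 \<and> frag_cmul n (frag_of i) \<in> L'" if i: "i \<in> J" for i
    proof -
      obtain n where "n \<noteq> 0" "frag_cmul n (frag_of i) \<in> L"
        using insert.prems(4)[of i] i by blast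
      thus ?thesis
        using i keys_cmul[of n "frag_of i"] by (auto simp: L'_def)
    qed
  qed (use insert.prems(2) in \<open>auto simp: L'_def\<close>)
  then obtain f where f: "bij_betw (frag_extend f) (carrier (free_Abelian_group J)) L'"
    by blast
  define P where "P n \<longleftrightarrow> n > 0 \<and> (\<exists>x\<in>L. Poly_Mapping.lookup x j = int n)" for n
  have "\<exists>n. P n"
  proof -
    obtain n where n: "n \<noteq> 0" "frag_cmul n (frag_of j) \<in> L"
      using insert.prems(4)[of j] by blast
    \<comment> \<open>\<open>n\<close> may be negative; its square gives a positive
      coefficient.\<close>
    have "frag_cmul (n * n) (frag_of j) \<in> L"
      using cmul[OF n(2), of n] by simp
    moreover have "n * n > 0"
      using n(1) by (simp add: zero_less_mult_iff linorder_neq_iff) linarith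
    ultimately have "P (nat (n * n))"
      unfolding P_def by (intro conjI bexI[of _ "frag_cmul (n * n) (frag_of j)"]) auto
    thus ?thesis ..
  qed
  define n where "n = (LEAST n. P n)"
  have "P n" unfolding n_def using \<open>\<exists>n. P n\<close> by (rule LeastI_ex)
  then obtain v where v: "v \<in> L" "Poly_Mapping.lookup v j = int n" and n: "n > 0"
    unfolding P_def by blast
  define q where "q x = Poly_Mapping.lookup x j div int n" for x
  have reduce: "x - frag_cmul (q x) v \<in> L'" if x: "x \<in> L" for x
  proof -
    let ?y = "x - frag_cmul (q x) v"
    have y: "?y \<in> L" using x v cmul diff by blast
    have c: "Poly_Mapping.lookup ?y j = Poly_Mapping.lookup x j mod int n"
      by (simp add: lookup_minus v q_def minus_div_mult_eq_mod)
    \<comment> \<open>A nonzero remainder would be a positive coefficient below the least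
      one.\<close>
    have "Poly_Mapping.lookup ?y j = 0"
    proof (rule ccontr)
      let ?m = "nat (Poly_Mapping.lookup ?y j)"
      assume "Poly_Mapping.lookup ?y j \<noteq> 0"
      moreover have "0 \<le> Poly_Mapping.lookup ?y j" "Poly_Mapping.lookup ?y j < int n"
        unfolding c using n by simp_all
      ultimately have "P ?m" "?m < n"
        unfolding P_def using y by auto
      thus False unfolding n_def using not_less_Least by blast
    qed
    thus ?thesis
      using y insert.prems(1) by (auto simp: L'_def in_keys_iff subset_iff)
  qed
  let ?g = "f(j := v)"
  have g: "frag_extend ?g y = frag_extend f y" if "Poly_Mapping.keys y \<subseteq> J" for y
    using that insert.hyps by (intro frag_extend_eq) auto
  have split: "frag_extend ?g x = frag_extend f (x - frag_cmul (Poly_Mapping.lookup x j) (frag_of j))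
        + frag_cmul (Poly_Mapping.lookup x j) v"
    and split_keys: "Poly_Mapping.keys (x - frag_cmul (Poly_Mapping.lookup x j) (frag_of j)) \<subseteq> J"
    if x: "Poly_Mapping.keys x \<subseteq> insert j J" for x
  proof -
    let ?c = "frag_cmul (Poly_Mapping.lookup x j) (frag_of j)"
    show keys: "Poly_Mapping.keys (x - ?c) \<subseteq> J"
    proof
      fix i assume "i \<in> Poly_Mapping.keys (x - ?c)"
      thus "i \<in> J"
        using x by (cases "i = j") (auto simp: in_keys_iff lookup_minus lookup_single)
    qed
    have "frag_extend ?g x = frag_extend ?g (x - ?c) + frag_extend ?g ?c"
      by (simp flip: frag_extend_add)
    thus "frag_extend ?g x = frag_extend f (x - ?c) + frag_cmul (Poly_Mapping.lookup x j) v"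
      by (simp add: g[OF keys] frag_extend_cmul)
  qed
  have f_in: "frag_extend f y \<in> L'" if "Poly_Mapping.keys y \<subseteq> J" for y
    using f that by (auto simp: bij_betw_def)
  have f_zero: "y = 0" if "Poly_Mapping.keys y \<subseteq> J" "frag_extend f y = 0" for y
    using f that unfolding bij_betw_def inj_on_def
    by (metis carrier_free_Abelian_group_iff frag_extend_0 keys_zero empty_subsetI)
  have "bij_betw (frag_extend ?g) (carrier (free_Abelian_group (insert j J))) L"
    unfolding bij_betw_def
  proof (intro conjI subset_antisym)
    show "inj_on (frag_extend ?g) (carrier (free_Abelian_group (insert j J)))"
    proof (rule inj_onI)
      fix x y
      assume "x \<in> carrier (free_Abelian_group (insert j J))"
        "y \<in> carrier (free_Abelian_group (insert j J))"
        and eq: "frag_extend ?g x = frag_extend ?g y"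
      hence k: "Poly_Mapping.keys (x - y) \<subseteq> insert j J"
        using keys_diff[of x y] by auto
      have z: "frag_extend ?g (x - y) = 0" using eq by (simp add: frag_extend_diff)
      let ?c = "Poly_Mapping.lookup (x - y) j"
      \<comment> \<open>Elements of \<open>L'\<close> have no \<open>j\<close>-coefficient, so the
        \<open>j\<close>-coefficient of the image of \<open>x - y\<close> is \<open>?c\<close> times
        \<open>n\<close>.\<close>
      have "Poly_Mapping.lookup (frag_extend f (x - y - frag_cmul ?c (frag_of j))) j = 0"
        using f_in[OF split_keys[OF k]] insert.hyps by (auto simp: L'_def in_keys_iff subset_iff)
      hence "?c * int n = 0"
        using arg_cong[OF z, of "\<lambda>z. Poly_Mapping.lookup z j"] split[OF k] v
        by (simp add: lookup_add)
      hence c: "?c = 0" using n by simp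
      hence "x - y = 0"
        using f_zero[of "x - y"] split[OF k] split_keys[OF k] z by simp
      thus "x = y" by simp
    qed
    show "frag_extend ?g ` carrier (free_Abelian_group (insert j J)) \<subseteq> L"
      using f_in[OF split_keys] split add cmul[OF v(1)] by (auto simp: L'_def)
    show "L \<subseteq> frag_extend ?g ` carrier (free_Abelian_group (insert j J))"
    proof
      fix x assume "x \<in> L"
      from reduce[OF this] f obtain y
        where y: "Poly_Mapping.keys y \<subseteq> J" "frag_extend f y = x - frag_cmul (q x) v"
        unfolding bij_betw_def by (metis carrier_free_Abelian_group_iff imageE)
      have "frag_extend ?g (y + frag_cmul (q x) (frag_of j)) = x"
        using y by (simp add: frag_extend_add frag_extend_cmul g)
      moreover have "Poly_Mapping.keys (y + frag_cmul (q x) (frag_of j)) \<subseteq> insert j J"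
        using y keys_add[of y "frag_cmul (q x) (frag_of j)"] keys_cmul[of "q x" "frag_of j"] by auto
      ultimately show "x \<in> frag_extend ?g ` carrier (free_Abelian_group (insert j J))"
        by (metis carrier_free_Abelian_group_iff imageI)
    qed
  qed
  thus ?case by blast
qed

lemma subgroup_free_Abelian_group_diff:
  assumes "subgroup L (free_Abelian_group J)" "x \<in> L" "y \<in> L"
  shows "x - y \<in> L"
  using subgroup.m_closed[OF assms(1,2) subgroup.m_inv_closed[OF assms(1,3)]]
    subgroup.mem_carrier[OF assms(1,3)] by simp

lemma full_rank_subgroup_iso:
  assumes "finite J" and L: "subgroup L (free_Abelian_group J)"
    and "\<And>j. j \<in> J \<Longrightarrow> \<exists>n. n \<noteq> 0 \<and> frag_cmul n (frag_of j) \<in> L"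
  shows "free_Abelian_group J \<cong> subgroup_generated (free_Abelian_group J) L"
proof -
  obtain f where f: "bij_betw (frag_extend f) (carrier (free_Abelian_group J)) L"
    using full_rank_sublattice_basis[OF assms(1) subgroup.subset[OF L]]
      subgroup.one_closed[OF L] subgroup_free_Abelian_group_diff[OF L] assms(3)
    by auto
  have "frag_extend f \<in> iso (free_Abelian_group J) (subgroup_generated (free_Abelian_group J) L)"
    using f by (intro isoI homI)
      (auto simp: subgroup.carrier_subgroup_generated_subgroup[OF L] frag_extend_add bij_betw_def)
  thus ?thesis by (auto simp: is_iso_def)
qed

section \<open>Finite powers of the integers and torsion-freeness\<close>

lemma free_Abelian_group_iso_product_group:
  assumes "finite J" "card J = n"
  shows "free_Abelian_group J \<cong> product_group {..<n} (\<lambda>_. integer_group)"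
proof -
  have "J \<approx> {..<n}"
    using assms by (simp add: eqpoll_iff_card)
  hence "free_Abelian_group J \<cong> free_Abelian_group {..<n}"
    by (simp add: isomorphic_free_Abelian_groups)
  also have "free_Abelian_group {..<n} \<cong> sum_group {..<n} (\<lambda>_. integer_group)"
    using group.iso_sym[OF sum_group isomorphic_sum_integer_group] by simp
  \<comment> \<open>\<open>sum_group\<close> is generated by the functions of finite support; over a
    finite index set these are all elements of the product.\<close>
  also have "sum_group {..<n} (\<lambda>_. integer_group) = product_group {..<n} (\<lambda>_. integer_group)"
    using group.subgroup_generated_group_carrier[OF product_group[of "{..<n}" "\<lambda>_. integer_group"]]
    by (simp add: sum_group_def)
  finally show ?thesis .
qed

lemma torsion_free_free_Abelian_group: "torsion_free (free_Abelian_group J)"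
  by (auto simp: torsion_free_def)

lemma torsion_free_iso:
  assumes "G \<cong> H" "group G" "group H" "torsion_free H"
  shows "torsion_free G"
  unfolding torsion_free_def
proof (intro ballI allI impI)
  fix x and n :: nat
  assume x: "x \<in> carrier G" and n: "n > 0" "x [^]\<^bsub>G\<^esub> n = \<one>\<^bsub>G\<^esub>"
  from assms(1) obtain h where h: "h \<in> iso G H" by (auto simp: is_iso_def)
  interpret group_hom G H h
    using assms h by (simp add: group_hom_def group_hom_axioms_def iso_def)
  have "h x [^]\<^bsub>H\<^esub> n = \<one>\<^bsub>H\<^esub>"
    using x n(2) by (metis hom_nat_pow hom_one)
  hence "h x = \<one>\<^bsub>H\<^esub>"
    using assms(4) x n(1) by (auto simp: torsion_free_def)
  thus "x = \<one>\<^bsub>G\<^esub>"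
    using h inj_onD[of h "carrier G" x "\<one>\<^bsub>G\<^esub>"] x by (simp add: iso_def bij_betw_def)
qed


section \<open>Words and presented groups\<close>

lemma words_simps [simp]:
  "[] \<in> words S"
  "s # w \<in> words S \<longleftrightarrow> snd s \<in> S \<and> w \<in> words S"
  "u @ v \<in> words S \<longleftrightarrow> u \<in> words S \<and> v \<in> words S"
  by (cases s; simp add: words_def)+

lemma word_class_eq_iff:
  assumes "u \<in> words S" "v \<in> words S"
  shows "word_rel S R `` {u} = word_rel S R `` {v} \<longleftrightarrow> word_eq S R u v"
  using eq_equiv_class_iff[OF equiv_word_rel assms] by (simp add: word_rel_def)

lemma one_presented_group: "\<one>\<^bsub>presented_group S R\<^esub> = word_rel S R `` {[]}"
  by (simp add: presented_group_def)

text \<open>Inverses in the presented group, brought back to words. They serve to reverse paths and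
  to cancel the action of a word.\<close>

lemma word_inverse:
  assumes u: "u \<in> words S"
  obtains v where "v \<in> words S" "word_eq S R (u @ v) []"
proof -
  let ?G = "presented_group S R"
  interpret group ?G by (rule group_presented_group)
  have c: "word_rel S R `` {u} \<in> carrier ?G" by (rule word_class_carrier[OF u])
  hence "inv\<^bsub>?G\<^esub> (word_rel S R `` {u}) \<in> words S // word_rel S R"
    using inv_closed[OF c] by (simp add: presented_group_def)
  then obtain v where v: "v \<in> words S" "inv\<^bsub>?G\<^esub> (word_rel S R `` {u}) = word_rel S R `` {v}"
    by (auto elim: quotientE)
  have "word_rel S R `` {u @ v} = word_rel S R `` {[]}"
    using r_inv[OF c] word_class_mult[OF u v(1)] v(2) by (simp add: one_presented_group)
  hence "word_eq S R (u @ v) []"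
    using u v by (simp add: word_class_eq_iff)
  with v(1) show thesis by (rule that)
qed

text \<open>A name for the relation set that \<open>structure_group\<close> leaves anonymous, so
  that \<open>word_eq\<close> can refer to it.\<close>

definition structure_relations :: "'a set \<Rightarrow> ('a \<Rightarrow> 'a \<Rightarrow> 'a) \<Rightarrow> ('a word \<times> 'a word) set"
  where "structure_relations X qop =
    {([(True, a), (True, b)], [(True, b), (True, qop a b)]) | a b. a \<in> X \<and> b \<in> X}"

lemma structure_group_eq:
  "structure_group X qop = presented_group X (structure_relations X qop)"
  by (simp add: structure_group_def structure_relations_def)

section \<open>Paths in the Cayley graph of a quandle\<close>

abbreviation tuples :: "'a set \<Rightarrow> nat \<Rightarrow> 'a list set"
  where "tuples X k \<equiv> {xs. length xs = k \<and> set xs \<subseteq> X}"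

definition rack_boundaries :: "'a set \<Rightarrow> ('a \<Rightarrow> 'a \<Rightarrow> 'a) \<Rightarrow> nat \<Rightarrow> ('a list \<Rightarrow>\<^sub>0 int) set"
  where "rack_boundaries X qop k = rack_boundary qop ` carrier (rack_chain_group X (k + 1))"

definition rack_cycles :: "'a set \<Rightarrow> ('a \<Rightarrow> 'a \<Rightarrow> 'a) \<Rightarrow> nat \<Rightarrow> ('a list \<Rightarrow>\<^sub>0 int) set"
  where "rack_cycles X qop k =
    kernel (rack_chain_group X k) (rack_chain_group X (k - 1)) (rack_boundary qop)"

lemma tuples_2E:
  assumes "xs \<in> tuples X 2"
  obtains a b where "xs = [a, b]" "a \<in> X" "b \<in> X"
  using assms by (auto simp: length_Suc_conv numeral_2_eq_2)

lemma tuples_3E: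
  assumes "xs \<in> tuples X 3"
  obtains a b c where "xs = [a, b, c]" "a \<in> X" "b \<in> X" "c \<in> X"
  using assms by (auto simp: length_Suc_conv numeral_3_eq_3)

lemma rack_boundary_diff [simp]:
  "rack_boundary qop (x - y) = rack_boundary qop x - rack_boundary qop y"
  by (simp add: rack_boundary_def frag_extend_diff)

lemma rack_boundary_add [simp]:
  "rack_boundary qop (x + y) = rack_boundary qop x + rack_boundary qop y"
  by (simp add: rack_boundary_def frag_extend_add)

lemma rack_boundary_minus [simp]: "rack_boundary qop (- x) = - rack_boundary qop x"
  by (simp add: rack_boundary_def frag_extend_minus)

lemma rack_boundary_0 [simp]: "rack_boundary qop 0 = 0"
  by (simp add: rack_boundary_def)

lemma mem_rack_boundaries:
  "z \<in> rack_boundaries X qop k \<longleftrightarrow>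
    (\<exists>c. Poly_Mapping.keys c \<subseteq> tuples X (k + 1) \<and> z = rack_boundary qop c)"
  unfolding rack_boundaries_def rack_chain_group_def image_iff carrier_free_Abelian_group_iff Bex_def ..

lemma rack_boundaries_0 [simp]: "0 \<in> rack_boundaries X qop k"
  unfolding mem_rack_boundaries by (rule exI[of _ 0]) simp

lemma rack_boundaries_diff:
  assumes "x \<in> rack_boundaries X qop k" "y \<in> rack_boundaries X qop k"
  shows "x - y \<in> rack_boundaries X qop k"
proof -
  obtain c d where cd: "x = rack_boundary qop c" "y = rack_boundary qop d"
    and "Poly_Mapping.keys c \<subseteq> tuples X (k + 1)" "Poly_Mapping.keys d \<subseteq> tuples X (k + 1)"
    using assms unfolding mem_rack_boundaries by blast
  hence "Poly_Mapping.keys (c - d) \<subseteq> tuples X (k + 1)"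
    using keys_diff[of c d] by blast
  thus ?thesis
    unfolding mem_rack_boundaries using cd by (intro exI[of _ "c - d"]) simp
qed

lemma rack_boundaries_minus:
  "x \<in> rack_boundaries X qop k \<Longrightarrow> - x \<in> rack_boundaries X qop k"
  using rack_boundaries_diff[OF rack_boundaries_0, of x] by simp

lemma rack_boundaries_add:
  "x \<in> rack_boundaries X qop k \<Longrightarrow> y \<in> rack_boundaries X qop k \<Longrightarrow> x + y \<in> rack_boundaries X qop k"
  using rack_boundaries_diff[of x X qop k "- y"] rack_boundaries_minus[of y X qop k] by simp

lemma rack_boundaries_sum:
  "(\<And>i. i \<in> I \<Longrightarrow> f i \<in> rack_boundaries X qop k) \<Longrightarrow> sum f I \<in> rack_boundaries X qop k"
  by (induction I rule: infinite_finite_induct) (simp_all add: rack_boundaries_add)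

text \<open>The boundary map is additive and the triples generate its domain, so properties closed
  under differences need only be checked on triples.\<close>

lemma rack_boundaries_2_induct [consumes 1, case_names zero basis diff]:
  assumes "z \<in> rack_boundaries X qop 2"
    and "P 0"
    and "\<And>a b c. a \<in> X \<Longrightarrow> b \<in> X \<Longrightarrow> c \<in> X \<Longrightarrow> P (rack_boundary qop (frag_of [a, b, c]))"
    and "\<And>x y. P x \<Longrightarrow> P y \<Longrightarrow> P (x - y)"
  shows "P z"
proof -
  obtain c where c: "z = rack_boundary qop c" "Poly_Mapping.keys c \<subseteq> tuples X 3"
    using assms(1) by (auto simp: mem_rack_boundaries numeral_3_eq_3)
  from c(2) have "P (rack_boundary qop c)"
  proof (induction c rule: frag_induction)
    case (one xs)
    thus ?case using assms(3) by (metis tuples_3E)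
  qed (simp_all add: assms)
  thus ?thesis by (simp add: c)
qed

lemma mem_rack_cycles:
  "z \<in> rack_cycles X qop k \<longleftrightarrow> Poly_Mapping.keys z \<subseteq> tuples X k \<and> rack_boundary qop z = 0"
  by (simp add: rack_cycles_def kernel_def rack_chain_group_def)

section \<open>Words acting on a quandle and the chains that they trace\<close>

context quandle
begin

text \<open>The inverse of the right translation by \<open>b\<close>; it will be the action of the
  letter \<open>(False, b)\<close>.\<close>

definition rdiv :: "'a \<Rightarrow> 'a \<Rightarrow> 'a"
  where "rdiv a b = inv_into X (\<lambda>x. qop x b) a"

lemma rdiv_closed [simp]: "a \<in> X \<Longrightarrow> b \<in> X \<Longrightarrow> rdiv a b \<in> X"
  using bij_betw_inv_into[OF right_translation_bij[of b]] by (auto simp: rdiv_def bij_betw_def)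

lemma qop_rdiv [simp]: "a \<in> X \<Longrightarrow> b \<in> X \<Longrightarrow> qop (rdiv a b) b = a"
  using bij_betw_inv_into_right[OF right_translation_bij[of b]] by (simp add: rdiv_def)

lemma rdiv_qop [simp]: "a \<in> X \<Longrightarrow> b \<in> X \<Longrightarrow> rdiv (qop a b) b = a"
  using bij_betw_inv_into_left[OF right_translation_bij[of b]] by (simp add: rdiv_def)

definition step :: "'a \<Rightarrow> bool \<times> 'a \<Rightarrow> 'a"
  where "step a s = (if fst s then qop a (snd s) else rdiv a (snd s))"

abbreviation act :: "'a \<Rightarrow> 'a word \<Rightarrow> 'a"
  where "act \<equiv> foldl step"

text \<open>A negative letter runs backwards along the edge that ends at \<open>a\<close>. That edge
  starts at \<open>rdiv a (snd s)\<close>, hence the sign and the changed first entry.\<close>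

definition edge :: "'a \<Rightarrow> bool \<times> 'a \<Rightarrow> 'a list \<Rightarrow>\<^sub>0 int"
  where "edge a s = (if fst s then frag_of [a, snd s] else - frag_of [rdiv a (snd s), snd s])"

fun path :: "'a \<Rightarrow> 'a word \<Rightarrow> 'a list \<Rightarrow>\<^sub>0 int"
  where
    "path a [] = 0"
  | "path a (s # w) = edge a s + path (step a s) w"

lemma path_append: "path a (u @ v) = path a u + path (act a u) v"
  by (induction u arbitrary: a) simp_all

lemma step_closed [simp]: "a \<in> X \<Longrightarrow> snd s \<in> X \<Longrightarrow> step a s \<in> X"
  by (simp add: step_def closed)

lemma act_closed [simp]: "a \<in> X \<Longrightarrow> w \<in> words X \<Longrightarrow> act a w \<in> X"
  by (induction w arbitrary: a) auto

lemma path_keys: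
  "a \<in> X \<Longrightarrow> w \<in> words X \<Longrightarrow> Poly_Mapping.keys (path a w) \<subseteq> tuples X 2"
proof (induction w arbitrary: a)
  case (Cons s w)
  have "Poly_Mapping.keys (edge a s) \<subseteq> tuples X 2"
    using Cons.prems by (auto simp: edge_def)
  moreover have "Poly_Mapping.keys (path (step a s) w) \<subseteq> tuples X 2"
    using Cons by simp
  ultimately show ?case
    using keys_add[of "edge a s" "path (step a s) w"] by (simp only: path.simps) blast
qed simp

lemma boundary_path:
  "a \<in> X \<Longrightarrow> w \<in> words X \<Longrightarrow> rack_boundary qop (path a w) = frag_of [act a w] - frag_of [a]"
proof (induction w arbitrary: a)
  case (Cons s w)
  have "rack_boundary qop (edge a s) = frag_of [step a s] - frag_of [a]"
    using Cons.prems by (simp add: edge_def step_def rack_boundary_2)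
  thus ?case using Cons by simp
qed simp

text \<open>Induction on the derivation. A cancelling pair goes along an edge and back. The two
  sides of a defining relation, read from \<open>a\<close>, bound a square which is the boundary of
  \<open>[a, b, c]\<close>; their end points agree by self-distributivity.\<close>

lemma word_eq_act_path:
  assumes "word_eq X (structure_relations X qop) u v" "a \<in> X"
  shows "act a u = act a v \<and> path a u - path a v \<in> rack_boundaries X qop 2"
  using assms
proof (induction arbitrary: a rule: word_eq.induct)
  case (refl w)
  thus ?case by simp
next
  case (sym u v)
  thus ?case using rack_boundaries_minus[of "path a u - path a v"] by simp
next
  case (trans u v w)
  thus ?case
    using rack_boundaries_add[where x = "path a u - path a v" and y = "path a v - path a w"] by simp
next
  case (append u u' v v')
  have "act a u \<in> X"
    using append.prems append.hyps(1)[THEN word_eq_words] by simp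
  with append have "act a u = act a u'" "act (act a u) v = act (act a u) v'"
    and "path a u - path a u' \<in> rack_boundaries X qop 2"
      "path (act a u) v - path (act a u) v' \<in> rack_boundaries X qop 2"
    by blast+
  with rack_boundaries_add[OF this(3,4)] show ?case
    by (simp add: path_append algebra_simps)
next
  case (cancel b e)
  thus ?case by (cases e) (simp_all add: step_def edge_def)
next
  case (relation u v)
  then obtain b c where uv: "u = [(True, b), (True, c)]" "v = [(True, c), (True, qop b c)]"
    and bc: "b \<in> X" "c \<in> X" unfolding structure_relations_def by blast
  have "path a u - path a v = rack_boundary qop (frag_of [a, b, c])"
    by (simp add: uv rack_boundary_3 step_def edge_def)
  moreover have "rack_boundary qop (frag_of [a, b, c]) \<in> rack_boundaries X qop 2"
    unfolding mem_rack_boundaries using relation.prems bc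
    by (intro exI[of _ "frag_of [a, b, c]"]) simp
  ultimately show ?case
    using self_distrib[OF relation.prems bc] by (simp add: uv step_def)
qed

text \<open>Appending a right inverse of \<open>u\<close> in the structure group brings both points
  back to where they started.\<close>

lemma act_inj:
  assumes "u \<in> words X" "a \<in> X" "b \<in> X" "act a u = act b u"
  shows "a = b"
proof -
  obtain v where "word_eq X (structure_relations X qop) (u @ v) []"
    using word_inverse[OF assms(1)] .
  hence "act a (u @ v) = a" "act b (u @ v) = b"
    using word_eq_act_path assms(2,3) by fastforce+
  thus ?thesis using assms(4) by simp
qed

section \<open>Orbits\<close>

abbreviation Inn :: "('a \<Rightarrow> 'a) monoid"
  where "Inn \<equiv> subgroup_generated (BijGroup X) (right_translation X qop ` X)"

abbreviation orb :: "'a \<Rightarrow> 'a set"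
  where "orb \<equiv> orbit Inn (\<lambda>f. f)"

definition rep :: "'a set \<Rightarrow> 'a"
  where "rep O1 = (SOME a. a \<in> X \<and> orb a = O1)"

lemma quandle_orbits_eq: "quandle_orbits X qop = orb ` X"
  by (auto simp: quandle_orbits_def orbits_def)

lemma right_translation_Bij: "b \<in> X \<Longrightarrow> right_translation X qop b \<in> carrier (BijGroup X)"
  using right_translation_bij[of b]
  by (simp add: BijGroup_def Bij_def right_translation_def cong: bij_betw_cong)

lemma Inn_action: "group_action Inn X (\<lambda>f. f)"
proof -
  interpret B: group "BijGroup X" by (rule group_BijGroup)
  have "(\<lambda>f. f) \<in> hom Inn (BijGroup X)"
    by (intro B.hom_from_subgroup_generated homI) auto
  thus ?thesis
    by (simp add: group_action_def group_hom_def group_hom_axioms_def B.is_group)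
qed

lemma orb_eqI:
  assumes "a \<in> X" "b \<in> orb a"
  shows "orb b = orb a"
proof -
  interpret group_action Inn X "\<lambda>f. f" by (rule Inn_action)
  have sub: "orb x \<subseteq> X" if "x \<in> X" for x
    using that element_image by (auto simp: orbit_def)
  have "b \<in> X" using sub assms by blast
  thus ?thesis
    using assms orbit_trans[of a b] orbit_trans[of b a] orbit_sym[of a b] sub by blast
qed

lemma orb_qop: "a \<in> X \<Longrightarrow> b \<in> X \<Longrightarrow> orb (qop a b) = orb a"
proof (rule orb_eqI)
  assume ab: "a \<in> X" "b \<in> X"
  have "right_translation X qop b \<in> carrier Inn"
    using group.subgroup_generated_subset_carrier_subset[OF group_BijGroup]
      right_translation_Bij ab by blast
  thus "qop a b \<in> orb a"
    unfolding orbit_def mem_Collect_eq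
    using ab by (intro exI[of _ "right_translation X qop b"]) (simp add: right_translation_def)
qed

lemma orb_step: "a \<in> X \<Longrightarrow> snd s \<in> X \<Longrightarrow> orb (step a s) = orb a"
  using orb_qop[of a "snd s"] orb_qop[of "rdiv a (snd s)" "snd s"] by (simp add: step_def)

text \<open>Ties the group \<open>Inn\<close> to words. Membership in \<open>Bij X\<close> is
  carried through the induction because the product of \<open>BijGroup X\<close> is composition only
  on bijections.\<close>

lemma Inn_eq_act:
  assumes "f \<in> generate (BijGroup X) (right_translation X qop ` X)"
  shows "f \<in> Bij X \<and> (\<exists>w\<in>words X. \<forall>a\<in>X. f a = act a w)"
  using assms
proof (induction rule: generate.induct)
  case one
  show ?case
    using id_Bij[of X] by (intro conjI bexI[of _ "[]"]) (auto simp: BijGroup_def restrict_def)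
next
  case (incl f)
  then obtain b where b: "b \<in> X" "f = right_translation X qop b" by blast
  show ?case
  proof (intro conjI bexI ballI)
    show "f \<in> Bij X" using b right_translation_Bij[of b] by (simp add: BijGroup_def)
    show "f a = act a [(True, b)]" if "a \<in> X" for a
      using b that by (simp add: step_def right_translation_def)
  qed (simp add: b)
next
  case (inv f)
  then obtain b where b: "b \<in> X" "f = right_translation X qop b" by blast
  hence f: "f \<in> Bij X" using right_translation_Bij[of b] by (simp add: BijGroup_def)
  have eq: "inv\<^bsub>BijGroup X\<^esub> f = (\<lambda>x\<in>X. inv_into X f x)" by (rule inv_BijGroup[OF f])
  have "inv_into X f a = rdiv a b" if "a \<in> X" for a
    using that b f by (intro inv_into_f_eq) (auto simp: Bij_def bij_betw_def right_translation_def)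
  hence "(inv\<^bsub>BijGroup X\<^esub> f) a = act a [(False, b)]" if "a \<in> X" for a
    using that by (simp add: eq step_def)
  moreover have "inv\<^bsub>BijGroup X\<^esub> f \<in> Bij X"
    unfolding eq by (rule restrict_inv_into_Bij[OF f])
  moreover have "[(False, b)] \<in> words X" using b by simp
  ultimately show ?case by blast
next
  case (eng f g)
  then obtain u v where uv: "u \<in> words X" "v \<in> words X" "f \<in> Bij X" "g \<in> Bij X"
    "\<forall>a\<in>X. f a = act a u" "\<forall>a\<in>X. g a = act a v" by blast
  hence "f \<otimes>\<^bsub>BijGroup X\<^esub> g = compose X f g" by (simp add: BijGroup_def)
  \<comment> \<open>\<open>compose\<close> applies \<open>g\<close> first while \<open>act\<close>
    reads words from the left, so the words are joined in reverse order.\<close>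
  with uv show ?case
    by (intro conjI bexI[of _ "v @ u"]) (auto simp: compose_Bij compose_eq)
qed

lemma orb_eq_act:
  assumes "a \<in> X" "b \<in> X" "orb a = orb b"
  obtains w where "w \<in> words X" "act a w = b"
proof -
  interpret group_action Inn X "\<lambda>f. f" by (rule Inn_action)
  have "b \<in> orb a" using assms orbit_refl by simp
  then obtain f where f: "f \<in> carrier Inn" "b = f a" by (auto simp: orbit_def)
  \<comment> \<open>\<open>subgroup_generated\<close> intersects its generating set with the
    carrier; here nothing is lost.\<close>
  have "carrier (BijGroup X) \<inter> right_translation X qop ` X = right_translation X qop ` X"
    using right_translation_Bij by blast
  with f have "f \<in> generate (BijGroup X) (right_translation X qop ` X)"
    by (simp add: carrier_subgroup_generated)
  with Inn_eq_act[OF this] f assms(1) that show thesis by metis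
qed

lemma rep: "O1 \<in> orb ` X \<Longrightarrow> rep O1 \<in> X \<and> orb (rep O1) = O1"
  unfolding rep_def by (rule someI_ex) auto

section \<open>Exponent sums by orbit and degrees by pairs of orbits\<close>

fun expo :: "'a word \<Rightarrow> 'a set \<Rightarrow>\<^sub>0 int"
  where
    "expo [] = 0"
  | "expo (s # w) = (if fst s then frag_of (orb (snd s)) else - frag_of (orb (snd s))) + expo w"

lemma keys_expo: "w \<in> words X \<Longrightarrow> Poly_Mapping.keys (expo w) \<subseteq> orb ` X"
proof (induction w)
  case (Cons s w)
  thus ?case
    using keys_add[of "frag_of (orb (snd s))" "expo w"] keys_diff[of "expo w" "frag_of (orb (snd s))"]
    by (cases "fst s") (simp_all, blast+)
qed simp

text \<open>The invariant that will embed the second homology group. It is used on chains of lists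
  of length two, where \<open>xs ! 0\<close> is the start of an edge and \<open>xs ! 1\<close> its
  label.\<close>

definition orbit_degree :: "('a list \<Rightarrow>\<^sub>0 int) \<Rightarrow> ('a set \<times> 'a set) \<Rightarrow>\<^sub>0 int"
  where "orbit_degree = frag_extend (\<lambda>xs. frag_of (orb (xs ! 0), orb (xs ! 1)))"

lemma orbit_degree_simps [simp]:
  "orbit_degree 0 = 0"
  "orbit_degree (frag_of [a, b]) = frag_of (orb a, orb b)"
  "orbit_degree (x + y) = orbit_degree x + orbit_degree y"
  "orbit_degree (x - y) = orbit_degree x - orbit_degree y"
  "orbit_degree (- x) = - orbit_degree x"
  by (simp_all add: orbit_degree_def frag_extend_add frag_extend_diff frag_extend_minus)

lemma orbit_degree_sum: "finite I \<Longrightarrow> orbit_degree (sum f I) = (\<Sum>i\<in>I. orbit_degree (f i))"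
  by (simp add: orbit_degree_def frag_extend_sum)

lemma keys_orbit_degree:
  assumes "Poly_Mapping.keys z \<subseteq> tuples X 2"
  shows "Poly_Mapping.keys (orbit_degree z) \<subseteq> orb ` X \<times> orb ` X"
proof -
  have "Poly_Mapping.keys (orbit_degree z) \<subseteq> (\<Union>xs\<in>tuples X 2. {(orb (xs ! 0), orb (xs ! 1))})"
    using keys_frag_extend[of "\<lambda>xs. frag_of (orb (xs ! 0), orb (xs ! 1))" z] assms
    unfolding orbit_degree_def keys_frag_of by blast
  also have "\<dots> \<subseteq> orb ` X \<times> orb ` X"
    by (auto elim!: tuples_2E)
  finally show ?thesis .
qed

text \<open>Since \<open>qop\<close> preserves orbits, the four terms of the boundary of a triple
  cancel in pairs.\<close>

lemma orbit_degree_boundary: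
  assumes "z \<in> rack_boundaries X qop 2"
  shows "orbit_degree z = 0"
  using assms
  by (induction rule: rack_boundaries_2_induct) (simp_all add: rack_boundary_3 orb_qop)

text \<open>A path never leaves the orbit of its start, so only pairs with first entry
  \<open>orb a\<close> occur, and these count the letters of each orbit with sign.\<close>

lemma lookup_orbit_degree_path:
  "a \<in> X \<Longrightarrow> w \<in> words X \<Longrightarrow> Poly_Mapping.lookup (orbit_degree (path a w)) (O1, O2) =
    (if O1 = orb a then Poly_Mapping.lookup (expo w) O2 else 0)"
proof (induction w arbitrary: a)
  case (Cons s w)
  have "orb (rdiv a (snd s)) = orb a"
    using Cons.prems orb_qop[of "rdiv a (snd s)" "snd s"] by simp
  thus ?case
    using Cons by (auto simp: lookup_add edge_def orb_step lookup_single)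
qed simp

text \<open>In the double boundary of a triple everything cancels at once except
  \<open>qop (qop a b) c\<close> against \<open>qop (qop a c) (qop b c)\<close>, which are equal by
  self-distributivity.\<close>

lemma boundaries_subset_cycles: "rack_boundaries X qop 2 \<subseteq> rack_cycles X qop 2"
proof
  fix z assume "z \<in> rack_boundaries X qop 2"
  thus "z \<in> rack_cycles X qop 2"
  proof (induction rule: rack_boundaries_2_induct)
    case zero
    show ?case by (simp add: mem_rack_cycles)
  next
    case (basis a b c)
    have "Poly_Mapping.keys (rack_boundary qop (frag_of [a, b, c])) \<subseteq> tuples X 2"
      unfolding rack_boundary_3 using basis
      by (intro order_trans[OF keys_add] order_trans[OF keys_diff] Un_least) (auto simp: closed)
    thus ?case
      using basis self_distrib by (simp add: mem_rack_cycles rack_boundary_3 rack_boundary_2)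
  next
    case (diff x y)
    thus ?case using keys_diff[of x y] by (auto simp: mem_rack_cycles)
  qed
qed

end

section \<open>Abelian structure groups\<close>

locale abelian_structure_quandle = quandle +
  assumes comm_structure_group: "comm_group (structure_group X qop)"
begin

abbreviation word_equiv :: "'a word \<Rightarrow> 'a word \<Rightarrow> bool" (infix "\<approx>\<^sub>w" 50)
  where "u \<approx>\<^sub>w v \<equiv> word_eq X (structure_relations X qop) u v"

abbreviation cls :: "'a word \<Rightarrow> 'a word set"
  where "cls u \<equiv> word_rel X (structure_relations X qop) `` {u}"

text \<open>After commuting the left side of the defining relation of \<open>a\<close> and
  \<open>b\<close>, the generator of \<open>b\<close> cancels.\<close>

lemma generator_qop:
  assumes "a \<in> X" "b \<in> X"
  shows "[(True, a)] \<approx>\<^sub>w [(True, qop a b)]"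
proof -
  interpret G: comm_group "structure_group X qop" by (rule comm_structure_group)
  let ?g = "\<lambda>x. cls [(True, x)]"
  have g: "?g x \<in> carrier (structure_group X qop)" if "x \<in> X" for x
    using that by (simp add: structure_group_eq word_class_carrier)
  have m: "?g x \<otimes>\<^bsub>structure_group X qop\<^esub> ?g y = cls [(True, x), (True, y)]"
    if "x \<in> X" "y \<in> X" for x y
    using that word_class_mult[of "[(True, x)]" X "[(True, y)]"] by (simp add: structure_group_eq)
  have "[(True, a), (True, b)] \<approx>\<^sub>w [(True, b), (True, qop a b)]"
    using assms closed by (intro word_eq.relation) (auto simp: structure_relations_def)
  hence "?g a \<otimes>\<^bsub>structure_group X qop\<^esub> ?g b = ?g b \<otimes>\<^bsub>structure_group X qop\<^esub> ?g (qop a b)"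
    using assms closed by (simp add: m word_class_eqI)
  hence "?g b \<otimes>\<^bsub>structure_group X qop\<^esub> ?g a = ?g b \<otimes>\<^bsub>structure_group X qop\<^esub> ?g (qop a b)"
    using assms by (simp add: G.m_comm g)
  hence "?g a = ?g (qop a b)"
    using assms closed by (simp add: g)
  thus ?thesis
    using assms closed by (simp add: word_class_eq_iff)
qed

lemma generator_step:
  assumes "a \<in> X" "snd s \<in> X"
  shows "[(True, a)] \<approx>\<^sub>w [(True, step a s)]"
  using generator_qop[of a "snd s"] word_eq.sym[OF generator_qop[of "rdiv a (snd s)" "snd s"]] assms
  by (simp add: step_def)

lemma generator_act:
  "a \<in> X \<Longrightarrow> w \<in> words X \<Longrightarrow> [(True, a)] \<approx>\<^sub>w [(True, act a w)]"
proof (induction w arbitrary: a)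
  case Nil
  thus ?case by (simp add: word_eq.refl)
next
  case (Cons s w)
  hence "[(True, a)] \<approx>\<^sub>w [(True, step a s)]"
    "[(True, step a s)] \<approx>\<^sub>w [(True, act (step a s) w)]"
    by (simp_all add: generator_step)
  thus ?case unfolding foldl_Cons by (rule word_eq.trans)
qed

lemma generator_orb:
  assumes "a \<in> X" "b \<in> X" "orb a = orb b"
  shows "[(True, a)] \<approx>\<^sub>w [(True, b)]"
proof -
  obtain w where "w \<in> words X" "act a w = b" by (rule orb_eq_act[OF assms])
  thus ?thesis using generator_act[OF assms(1)] by blast
qed

text \<open>By \<open>generator_orb\<close> a generator depends only on its orbit. Sending each
  orbit to its generator thus defines a homomorphism \<open>h\<close> on the free abelian group of
  the orbits, and \<open>h (expo w)\<close> is the class of \<open>w\<close> for every word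
  \<open>w\<close>.\<close>

lemma word_trivial:
  assumes "u \<in> words X" "expo u = 0"
  shows "u \<approx>\<^sub>w []"
proof -
  let ?G = "structure_group X qop" and ?F = "free_Abelian_group (orb ` X)"
  interpret G: comm_group ?G by (rule comm_structure_group)
  have carrier: "cls w \<in> carrier ?G" if "w \<in> words X" for w
    using that by (simp add: structure_group_eq word_class_carrier)
  have mult: "cls v \<otimes>\<^bsub>?G\<^esub> cls w = cls (v @ w)" if "v \<in> words X" "w \<in> words X" for v w
    using that by (simp add: structure_group_eq word_class_mult)
  have one: "\<one>\<^bsub>?G\<^esub> = cls []"
    by (simp add: structure_group_eq one_presented_group)
  have "(\<lambda>O1. cls [(True, rep O1)]) ` orb ` X \<subseteq> carrier ?G"
    using rep carrier by (simp add: image_subset_iff del: image_iff)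
  then obtain h where h: "h \<in> hom ?F ?G"
    and h_orb: "\<And>O1. O1 \<in> orb ` X \<Longrightarrow> h (frag_of O1) = cls [(True, rep O1)]"
    by (rule G.free_Abelian_group_universal) blast
  interpret h: group_hom ?F ?G h
    by (simp add: group_hom_def group_hom_axioms_def h G.is_group)
  have h_gen: "h (frag_of (orb b)) = cls [(True, b)]" if "b \<in> X" for b
    using h_orb[of "orb b"] generator_orb[of "rep (orb b)" b] rep[of "orb b"] that
    by (simp add: word_class_eqI)
  have h_letter: "h (expo [s]) = cls [s]" if s: "snd s \<in> X" for s
  proof (cases s)
    case (Pair e b)
    show ?thesis
    proof (cases e)
      case True
      thus ?thesis using Pair s h_gen by simp
    next
      case False
      have "cls ([(False, b)] @ [(True, b)]) = cls []"
        using s Pair word_eq.cancel[of b X _ False] by (intro word_class_eqI) simp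
      hence "cls [(False, b)] \<otimes>\<^bsub>?G\<^esub> cls [(True, b)] = \<one>\<^bsub>?G\<^esub>"
        using s Pair by (simp add: mult one)
      hence "inv\<^bsub>?G\<^esub> cls [(True, b)] = cls [(False, b)]"
        using s Pair by (intro G.inv_equality carrier) simp_all
      moreover have "h (- frag_of (orb b)) = inv\<^bsub>?G\<^esub> h (frag_of (orb b))"
        using h.hom_inv[of "frag_of (orb b)"] s Pair by simp
      ultimately show ?thesis using Pair False s h_gen by simp
    qed
  qed
  have "h (expo w) = cls w" if "w \<in> words X" for w
    using that
  proof (induction w)
    case Nil
    show ?case using h.hom_one by (simp add: one)
  next
    case (Cons s w)
    have keys: "Poly_Mapping.keys (expo [s]) \<subseteq> orb ` X" "Poly_Mapping.keys (expo w) \<subseteq> orb ` X"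
      using keys_expo[of "[s]"] keys_expo[of w] Cons.prems by simp_all
    have "h (expo (s # w)) = h (expo [s]) \<otimes>\<^bsub>?G\<^esub> h (expo w)"
      using h.hom_mult[of "expo [s]" "expo w"] keys by simp
    thus ?case
      using Cons h_letter mult[of "[s]" w] by simp
  qed
  from this[OF assms(1)] have "cls u = cls []"
    using assms(2) h.hom_one by (simp add: one)
  thus ?thesis
    using assms(1) by (simp add: word_class_eq_iff)
qed

section \<open>Decomposition of chains into loops at base points\<close>

definition connect :: "'a \<Rightarrow> 'a word"
  where "connect a = (SOME w. w \<in> words X \<and> act (rep (orb a)) w = a)"

lemma connect: "a \<in> X \<Longrightarrow> connect a \<in> words X \<and> act (rep (orb a)) (connect a) = a"
  unfolding connect_def
proof (rule someI_ex)
  assume "a \<in> X"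
  with rep[of "orb a"] have "rep (orb a) \<in> X" "orb (rep (orb a)) = orb a" by auto
  with \<open>a \<in> X\<close> show "\<exists>w. w \<in> words X \<and> act (rep (orb a)) w = a"
    using orb_eq_act[of "rep (orb a)" a] by blast
qed

text \<open>Meant for chains of lists with one entry: each vertex is replaced by the chosen path
  that leads to it from the base point of its orbit.\<close>

definition base_path :: "('a list \<Rightarrow>\<^sub>0 int) \<Rightarrow> ('a list \<Rightarrow>\<^sub>0 int)"
  where "base_path = frag_extend (\<lambda>xs. path (rep (orb (hd xs))) (connect (hd xs)))"

text \<open>Stated for all chains and not only for cycles, so that induction over basis elements
  applies; the correction \<open>base_path (rack_boundary qop z)\<close> vanishes when
  \<open>z\<close> is a cycle. A single edge is closed to a loop by joining both its ends to the
  base point.\<close>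

lemma chain_eq_loops:
  assumes "finite X" and z: "Poly_Mapping.keys z \<subseteq> tuples X 2"
  shows "\<exists>U. (\<forall>O1\<in>orb ` X. U O1 \<in> words X \<and> act (rep O1) (U O1) = rep O1) \<and>
    z - base_path (rack_boundary qop z) - (\<Sum>O1\<in>orb ` X. path (rep O1) (U O1))
      \<in> rack_boundaries X qop 2"
  using z
proof (induction z rule: frag_induction)
  case zero
  show ?case
    by (rule exI[of _ "\<lambda>_. []"]) (simp add: base_path_def)
next
  case (one xs)
  then obtain a b where xs: "xs = [a, b]" and ab: "a \<in> X" "b \<in> X" by (rule tuples_2E)
  let ?c = "qop a b" and ?x = "rep (orb a)"
  have c: "?c \<in> X" and orb_c: "orb ?c = orb a"
    using ab by (simp_all add: closed orb_qop)
  have x: "?x \<in> X" using rep[of "orb a"] ab by blast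
  note con_a = connect[OF ab(1)] and con_c = connect[OF c, unfolded orb_c]
  \<comment> \<open>\<open>v\<close> undoes \<open>connect ?c\<close> in the structure group: read
    from \<open>?c\<close> it returns to the base point, and its path cancels that of
    \<open>connect ?c\<close> modulo boundaries.\<close>
  obtain v where v: "v \<in> words X" and "connect ?c @ v \<approx>\<^sub>w []"
    using word_inverse[of "connect ?c" X] con_c by blast
  from word_eq_act_path[OF this(2) x] con_c have return: "act ?c v = ?x"
    and bd: "path ?x (connect ?c) + path ?c v \<in> rack_boundaries X qop 2"
    by (simp_all add: path_append)
  let ?l = "connect a @ (True, b) # v"
  let ?U = "\<lambda>O1. if O1 = orb a then ?l else []"
  have loop: "?l \<in> words X" "act ?x ?l = ?x"
    using v ab con_a return by (simp_all add: step_def)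
  have "(\<Sum>O1\<in>orb ` X. path (rep O1) (?U O1)) = (\<Sum>O1\<in>orb ` X. if O1 = orb a then path ?x ?l else 0)"
    by (rule sum.cong) auto
  also have "\<dots> = path ?x ?l"
    using assms(1) ab by simp
  also have "\<dots> = path ?x (connect a) + (frag_of [a, b] + path ?c v)"
    using con_a by (simp add: path_append edge_def step_def)
  finally have sum: "(\<Sum>O1\<in>orb ` X. path (rep O1) (?U O1)) =
    path ?x (connect a) + (frag_of [a, b] + path ?c v)" .
  have "base_path (rack_boundary qop (frag_of xs)) = path ?x (connect ?c) - path ?x (connect a)"
    by (simp add: xs rack_boundary_2 base_path_def frag_extend_diff orb_c)
  hence "frag_of xs - base_path (rack_boundary qop (frag_of xs)) - (\<Sum>O1\<in>orb ` X. path (rep O1) (?U O1))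
      = - (path ?x (connect ?c) + path ?c v)"
    unfolding sum xs by (simp add: algebra_simps)
  with rack_boundaries_minus[OF bd] loop show ?case
    by (intro exI[of _ ?U]) auto
next
  case (diff y z)
  let ?loop = "\<lambda>U. \<forall>O1\<in>orb ` X. U O1 \<in> words X \<and> act (rep O1) (U O1) = rep O1"
  let ?s = "\<lambda>U. \<Sum>O1\<in>orb ` X. path (rep O1) (U O1)"
  from diff obtain U V where U: "?loop U"
      "y - base_path (rack_boundary qop y) - ?s U \<in> rack_boundaries X qop 2"
    and V: "?loop V"
      "z - base_path (rack_boundary qop z) - ?s V \<in> rack_boundaries X qop 2"
    by blast
  \<comment> \<open>Subtracting the loop \<open>V O1\<close> amounts, modulo boundaries, to
    following an inverse word \<open>W O1\<close>, so the difference again has one loop per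
    orbit.\<close>
  have "\<forall>O1\<in>orb ` X. \<exists>w. w \<in> words X \<and> V O1 @ w \<approx>\<^sub>w []"
    using V(1) word_inverse by metis
  then obtain W where W: "\<And>O1. O1 \<in> orb ` X \<Longrightarrow> W O1 \<in> words X \<and> V O1 @ W O1 \<approx>\<^sub>w []"
    by metis
  have W': "act (rep O1) (W O1) = rep O1"
    "path (rep O1) (V O1) + path (rep O1) (W O1) \<in> rack_boundaries X qop 2"
    if "O1 \<in> orb ` X" for O1
    using word_eq_act_path[of "V O1 @ W O1" "[]" "rep O1"] W[OF that] rep[OF that] V(1) that
    by (simp_all add: path_append)
  let ?UW = "\<lambda>O1. U O1 @ W O1"
  have "?s ?UW = ?s U + ?s W"
    unfolding sum.distrib[symmetric]
    by (intro sum.cong[OF HOL.refl]) (simp only: path_append U(1)[rule_format])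
  moreover have "?s V + ?s W \<in> rack_boundaries X qop 2"
    unfolding sum.distrib[symmetric] by (intro rack_boundaries_sum W'(2))
  ultimately have "(y - z) - base_path (rack_boundary qop (y - z)) - ?s ?UW \<in> rack_boundaries X qop 2"
    using rack_boundaries_diff[OF rack_boundaries_diff[OF U(2) V(2)], of "?s V + ?s W"]
    by (simp add: base_path_def frag_extend_diff algebra_simps)
  moreover have "?loop ?UW"
    using U(1) W W'(1) by simp
  ultimately show ?case by (intro exI[of _ ?UW]) blast
qed

text \<open>Modulo boundaries \<open>z\<close> is a sum of loops, one per orbit. The coefficients of
  the degree at the pairs \<open>(O1, O2)\<close> are the exponent sums of the loop at
  \<open>rep O1\<close> alone. Hence each loop spells a trivial element of the structure group and
  is a boundary.\<close>

lemma orbit_degree_inj: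
  assumes "finite X" and z: "z \<in> rack_cycles X qop 2" and deg: "orbit_degree z = 0"
  shows "z \<in> rack_boundaries X qop 2"
proof -
  let ?s = "\<lambda>U. \<Sum>O1\<in>orb ` X. path (rep O1) (U O1)"
  have z': "Poly_Mapping.keys z \<subseteq> tuples X 2" "rack_boundary qop z = 0"
    using z by (simp_all add: mem_rack_cycles)
  then obtain U where U: "\<And>O1. O1 \<in> orb ` X \<Longrightarrow> U O1 \<in> words X"
    and bd: "z - ?s U \<in> rack_boundaries X qop 2"
    using chain_eq_loops[OF assms(1) z'(1)] by (auto simp: base_path_def)
  have fin: "finite (orb ` X)" using assms(1) by simp
  have deg_s: "orbit_degree (?s U) = 0"
    using orbit_degree_boundary[OF bd] deg by simp
  have "path (rep O1) (U O1) \<in> rack_boundaries X qop 2" if O1: "O1 \<in> orb ` X" for O1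
  proof -
    have "Poly_Mapping.lookup (expo (U O1)) O2 = 0" for O2
    proof -
      have "0 = Poly_Mapping.lookup (orbit_degree (?s U)) (O1, O2)"
        by (simp add: deg_s)
      also have "\<dots> = (\<Sum>O3\<in>orb ` X. Poly_Mapping.lookup (orbit_degree (path (rep O3) (U O3))) (O1, O2))"
        by (simp only: orbit_degree_sum[OF fin] lookup_sum)
      also have "\<dots> = (\<Sum>O3\<in>orb ` X. if O1 = O3 then Poly_Mapping.lookup (expo (U O3)) O2 else 0)"
        by (rule sum.cong[OF HOL.refl]) (use rep U in \<open>simp add: lookup_orbit_degree_path\<close>)
      also have "\<dots> = Poly_Mapping.lookup (expo (U O1)) O2"
        using fin O1 by simp
      finally show ?thesis by simp
    qed
    hence "expo (U O1) = 0" by (intro poly_mapping_eqI) simp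
    hence "U O1 \<approx>\<^sub>w []" by (rule word_trivial[OF U[OF O1]])
    thus ?thesis
      using word_eq_act_path[of "U O1" "[]" "rep O1"] rep[OF O1] by simp
  qed
  hence "?s U \<in> rack_boundaries X qop 2" by (rule rack_boundaries_sum)
  from rack_boundaries_add[OF bd this] show ?thesis by simp
qed

end

section \<open>Finite periods and the rank of the image\<close>

context quandle
begin

text \<open>By the pigeonhole principle two powers of the letter \<open>s\<close> agree at
  \<open>a\<close>; cancelling the smaller one leaves a period.\<close>

lemma replicate_period:
  assumes "finite X" "a \<in> X" "snd s \<in> X"
  obtains n where "n > 0" "act a (replicate n s) = a"
proof -
  have words: "replicate n s \<in> words X" for n
    using assms(3) by (induction n) simp_all
  have "range (\<lambda>n. act a (replicate n s)) \<subseteq> X"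
    using assms words by auto
  hence "\<not> inj (\<lambda>n. act a (replicate n s))"
    using assms(1) finite_subset finite_imageD infinite_UNIV_nat by blast
  then obtain m n where "m < n" and eq: "act a (replicate m s) = act a (replicate n s)"
    unfolding inj_def by (metis linorder_neqE_nat)
  \<comment> \<open>The excess is put first, so that \<open>act_inj\<close> can cancel the common
    tail.\<close>
  have "replicate n s = replicate (n - m) s @ replicate m s"
    using \<open>m < n\<close> by (simp flip: replicate_add)
  hence "act (act a (replicate (n - m) s)) (replicate m s) = act a (replicate m s)"
    using eq by simp
  hence "act a (replicate (n - m) s) = a"
    using act_inj[OF words[of m]] assms(2) words by simp
  with \<open>m < n\<close> show thesis by (intro that[of "n - m"]) simp_all
qed

text \<open>Reading the letter \<open>b\<close> from \<open>a\<close> for a full period gives a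
  closed path, a cycle whose degree is the period times the pair of orbits.\<close>

lemma orbit_degree_image_full_rank:
  assumes "finite X" "j \<in> orb ` X \<times> orb ` X"
  shows "\<exists>n. n \<noteq> 0 \<and> frag_cmul n (frag_of j) \<in> orbit_degree ` rack_cycles X qop 2"
proof -
  obtain a b where j: "j = (orb a, orb b)" and ab: "a \<in> X" "b \<in> X"
    using assms(2) by blast
  obtain n where n: "n > 0" "act a (replicate n (True, b)) = a"
    using replicate_period[OF assms(1) ab(1), of "(True, b)"] ab by auto
  let ?w = "replicate n (True, b)"
  have w: "?w \<in> words X" using ab by (induction n) simp_all
  have "path a ?w \<in> rack_cycles X qop 2"
    using path_keys[OF ab(1) w] boundary_path[OF ab(1) w] n by (simp add: mem_rack_cycles)
  moreover have e: "expo ?w = frag_cmul (int n) (frag_of (orb b))"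
    by (induction n) (simp_all add: frag_cmul_distrib)
  moreover have "orbit_degree (path a ?w) = frag_cmul (int n) (frag_of j)"
  proof (intro poly_mapping_eqI)
    fix k :: "'a set \<times> 'a set"
    obtain O1 O2 where k: "k = (O1, O2)" by (cases k)
    show "Poly_Mapping.lookup (orbit_degree (path a ?w)) k =
        Poly_Mapping.lookup (frag_cmul (int n) (frag_of j)) k"
      unfolding k lookup_orbit_degree_path[OF ab(1) w] e j by (simp add: lookup_single when_def)
  qed
  ultimately show ?thesis
    using n(1) by (intro exI[of _ "int n"]) (auto intro: rev_image_eqI)
qed

lemma subgroup_rack_cycles:
  "subgroup (rack_cycles X qop 2) (rack_chain_group X 2)"
proof -
  \<comment> \<open>\<open>rack_boundary\<close> is defined on chains of every degree; to be a
    homomorphism between the two chain groups it must land in degree one.\<close>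
  have "rack_boundary qop z \<in> carrier (rack_chain_group X 1)" if "z \<in> carrier (rack_chain_group X 2)" for z
  proof -
    have "Poly_Mapping.keys z \<subseteq> tuples X 2" using that by (simp add: rack_chain_group_def)
    hence "Poly_Mapping.keys (rack_boundary qop z) \<subseteq> tuples X 1"
    proof (induction z rule: frag_induction)
      case (one xs)
      thus ?case
        using keys_diff by (fastforce elim!: tuples_2E simp: rack_boundary_2 closed)
    next
      case (diff y z)
      thus ?case using keys_diff by fastforce
    qed simp
    thus ?thesis by (simp add: rack_chain_group_def)
  qed
  hence "group_hom (rack_chain_group X 2) (rack_chain_group X 1) (rack_boundary qop)"
    by (auto simp: group_hom_def group_hom_axioms_def rack_chain_group_def intro!: homI)
  thus ?thesis
    unfolding rack_cycles_def using group_hom.subgroup_kernel by fastforce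
qed

end

text \<open>The first isomorphism theorem for \<open>orbit_degree\<close> on cycles: its kernel
  consists of the boundaries and its image has full rank. The second conclusion serves to transfer
  torsion-freeness.\<close>

theorem (in abelian_structure_quandle) rack_homology_2_iso:
  assumes "finite X"
  shows "rack_homology X qop 2 \<cong> free_Abelian_group (orb ` X \<times> orb ` X)"
    and "group (rack_homology X qop 2)"
proof -
  let ?C = "rack_chain_group X 2" and ?Z = "rack_cycles X qop 2"
  let ?F = "free_Abelian_group (orb ` X \<times> orb ` X)"
  let ?L = "orbit_degree ` ?Z"
  interpret C: group ?C by (simp add: rack_chain_group_def)
  interpret F: group ?F by simp
  note Z = subgroup_rack_cycles
  have carrier: "carrier (subgroup_generated ?C ?Z) = ?Z"
    by (rule subgroup.carrier_subgroup_generated_subgroup[OF Z])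
  have "orbit_degree \<in> hom ?C ?F"
    using keys_orbit_degree by (intro homI) (simp_all add: rack_chain_group_def)
  hence hom: "orbit_degree \<in> hom (subgroup_generated ?C ?Z) ?F"
    by (rule C.hom_from_subgroup_generated)
  then interpret D: group_hom "subgroup_generated ?C ?Z" ?F orbit_degree
    by (simp add: group_hom_def group_hom_axioms_def)
  have L: "subgroup ?L ?F"
    using D.img_is_subgroup by (simp add: carrier)
  \<comment> \<open>The target is cut down to the image, to make the homomorphism
    surjective.\<close>
  let ?H = "subgroup_generated ?F ?L"
  have carrier_L: "carrier ?H = ?L"
    by (rule subgroup.carrier_subgroup_generated_subgroup[OF L])
  interpret D': group_hom "subgroup_generated ?C ?Z" ?H orbit_degree
    using hom by (simp add: group_hom_def group_hom_axioms_def hom_def carrier carrier_L Pi_iff)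
  have "kernel (subgroup_generated ?C ?Z) ?H orbit_degree = rack_boundaries X qop 2"
    using orbit_degree_inj[OF assms] orbit_degree_boundary boundaries_subset_cycles
    by (auto simp: kernel_def carrier)
  hence eq: "rack_homology X qop 2 =
      subgroup_generated ?C ?Z Mod kernel (subgroup_generated ?C ?Z) ?H orbit_degree"
    by (simp add: rack_homology_def rack_boundaries_def rack_cycles_def)
  have "rack_homology X qop 2 \<cong> ?H"
    unfolding eq by (rule D'.FactGroup_iso) (simp add: carrier carrier_L)
  \<comment> \<open>The image may be a proper subgroup, but having full rank it is isomorphic to the
    whole group.\<close>
  moreover have "?F \<cong> ?H"
    using assms by (intro full_rank_subgroup_iso L orbit_degree_image_full_rank) simp_all
  hence "?H \<cong> ?F" by (rule F.iso_sym)
  ultimately show "rack_homology X qop 2 \<cong> ?F" by (rule iso_trans)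
  show "group (rack_homology X qop 2)"
    unfolding eq using D'.normal_kernel by (rule normal.factorgroup_is_group)
qed

theorem corollary7p3:
  fixes X :: "'a set" and qop :: "'a \<Rightarrow> 'a \<Rightarrow> 'a" and r :: nat
  assumes "quandle X qop"
    and "finite X"
    and "card (quandle_orbits X qop) = r"
    and "comm_group (structure_group X qop)"
  shows "torsion_free (rack_homology X qop 2) \<and>
         rack_homology X qop 2 \<cong> product_group {..<r\<^sup>2} (\<lambda>_. integer_group)"
proof -
  interpret abelian_structure_quandle X qop
    using assms(1,4) by (simp add: abelian_structure_quandle_def abelian_structure_quandle_axioms_def)
  have "card (orb ` X \<times> orb ` X) = r\<^sup>2"
    using assms(3) by (simp add: quandle_orbits_eq card_cartesian_product power2_eq_square)
  hence "free_Abelian_group (orb ` X \<times> orb ` X) \<cong> product_group {..<r\<^sup>2} (\<lambda>_. integer_group)"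
    using assms(2) by (intro free_Abelian_group_iso_product_group) simp_all
  thus ?thesis
    using rack_homology_2_iso[OF assms(2)] iso_trans
      torsion_free_iso[OF _ _ group_free_Abelian_group torsion_free_free_Abelian_group]
    by blast
qed

end
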